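(* Let $\lambda=-1/\gamma=\frac{1-\sqrt5}2$, where $\gamma=\frac{1+\sqrt5}2$. For $z\in[0,1)^2$ the minimal period length $\pi(z)$ is: \begin{itemize} \item $1$ if $z\in\left\{(0,0),\left(\frac1{\gamma^2+1},\frac1{\gamma^2+1}\right),\left(\frac2{\gamma^2+1},\frac2{\gamma^2+1}\right)\right\}$; \item $5$ for the other points of $D_A$ and $D_B$; \item $2(5\cdot4^n+1)/3$ if $S^nR(z)=\left(\frac{\gamma^2}{\gamma^2+1},\frac{\gamma^2}{\gamma^2+1}\right)$ for some $n\ge0$; \item $10(5\cdot4^n+1)/3$ for the other points with $S^nR(z)\in D_\alpha$ for some $n\ge0$; \item $(5\cdot4^n-2)/3$ if $S^nR(z)=\left(\frac3{\gamma^2+1},\frac3{\gamma^2+1}\right)$ for some $n\ge0$; \item $5(5\cdot4^n-2)/3$ for the other points with $S^nR(z)\in D_\beta$ for some $n\ge0$; \item $\infty$ if $S^nR(z)\in\mathcal D\setminus\mathcal P$ for all $n\ge0$. \end{itemize}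
   Context: $T:[0,1)^2\to[0,1)^2$ is the bijection $T(x,y)=(y,\{-x-\gamma y\})$ ($\{\cdot\}$ the fractional part), i.e. $T(x,y)=(x,y)A+(0,\lceil x+\gamma y\rceil)$ with $A=\begin{pmatrix}0&-1\\1&-\gamma\end{pmatrix}$ (row vectors). $\pi(z)$ is the least $p\ge1$ with $T^p(z)=z$, and $\infty$ if none exists. $\mathcal D=\{(x,y)\in[0,1)^2:x+y\ge3-\gamma\}$; $\mathcal R=\{z\in[0,1)^2:T^m(z)\notin\mathcal D\text{ for all }m\ge0\}$, which equals $\{(0,0)\}\cup D_A\cup D_B$ with $D_A=\{z\in[0,1)^2:T^{k+1}(z)=T^k(z)A+(0,1)\text{ for all }k\ge0\}$ and $D_B=\{z\in[0,1)^2:T^{k+1}(z)=T^k(z)A+(0,2)\text{ for all }k\ge0\}$. For $z\notin\mathcal R$, $R(z)=T^{r(z)}(z)$ with $r(z)=\min\{m\ge0:T^m(z)\in\mathcal D\}$. $\hat T:\mathcal D\to\mathcal D$ is the first return map of $T$ to $\mathcal D$, $\hat T(z)=R(T(z))$ (a bijection). $U(z)=z/\gamma^2+(1/\gamma,1/\gamma)$, $D_\alpha=U(D_A)$, $D_\beta=U(D_B)$, and $\mathcal P=\{z\in\mathcal D:\hat T^m(z)\notin U(\mathcal D)\text{ for all }m\in\mathbb Z\}=D_\alpha\cup D_\beta$. For $z\in\mathcal D\setminus\mathcal P$ fix $\hat s(z)$ as either $\min\{m\ge0:\hat T^m(z)\in U(\mathcal D)\}$ or $\max\{m\le0:\hat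 T^m(z)\in U(\mathcal D)\}$ (one that exists), and let $S(z)=U^{-1}\hat T^{\hat s(z)}(z)$, $S:\mathcal D\setminus\mathcal P\to\mathcal D$. For $z\notin\mathcal R$: $S^0R(z)=R(z)$, and $S^nR(z)=S(S^{n-1}R(z))$ is defined as long as $S^{n-1}R(z)$ is defined and in $\mathcal D\setminus\mathcal P$. Conditions on $S^nR(z)$ include that $z\notin\mathcal R$ and that it is defined. *)

theory Defs
  imports "HOL-Analysis.Analysis"
begin

definition golden :: real where
  "golden = (1 + sqrt 5) / 2"

definition unit_square :: "(real \<times> real) set" where
  "unit_square = {0..<1} \<times> {0..<1}"

fun T :: "real \<times> real \<Rightarrow> real \<times> real" where
  "T (x, y) = (y, frac (- x - golden * y))"

text \<open>The product of the row vector \<open>(x, y)\<close> with the matrix \<open>A\<close> whose rows are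
  \<open>(0, -1)\<close> and \<open>(1, -golden)\<close>.\<close>

fun mult_A :: "real \<times> real \<Rightarrow> real \<times> real" where
  "mult_A (x, y) = (y, - x - golden * y)"

definition min_period :: "real \<times> real \<Rightarrow> enat" where
  "min_period z =
     (if \<exists>p\<ge>1. (T ^^ p) z = z then enat (LEAST p. p \<ge> 1 \<and> (T ^^ p) z = z) else \<infinity>)"

definition domD :: "(real \<times> real) set" where
  "domD = {(x, y). (x, y) \<in> unit_square \<and> x + y \<ge> 3 - golden}"

definition setR :: "(real \<times> real) set" where
  "setR = {z \<in> unit_square. \<forall>m. (T ^^ m) z \<notin> domD}"

definition D_A :: "(real \<times> real) set" where
  "D_A = {z \<in> unit_square. \<forall>k. (T ^^ Suc k) z = mult_A ((T ^^ k) z) + (0, 1)}"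

definition D_B :: "(real \<times> real) set" where
  "D_B = {z \<in> unit_square. \<forall>k. (T ^^ Suc k) z = mult_A ((T ^^ k) z) + (0, 2)}"

text \<open>\<open>r\<close> and \<open>R\<close> are meaningful only on \<open>unit_square - setR\<close>.\<close>

definition r :: "real \<times> real \<Rightarrow> nat" where
  "r z = (LEAST m. (T ^^ m) z \<in> domD)"

definition R :: "real \<times> real \<Rightarrow> real \<times> real" where
  "R z = (T ^^ r z) z"

definition T_hat :: "real \<times> real \<Rightarrow> real \<times> real" where
  "T_hat z = R (T z)"

text \<open>Integer powers of \<open>T_hat\<close>, taken as a bijection of \<open>domD\<close>; meaningful only for
  arguments in \<open>domD\<close>.\<close>

definition T_hat_pow :: "int \<Rightarrow> real \<times> real \<Rightarrow> real \<times> real" where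
  "T_hat_pow m z =
     (if m \<ge> 0 then (T_hat ^^ nat m) z else (inv_into domD T_hat ^^ nat (- m)) z)"

definition U :: "real \<times> real \<Rightarrow> real \<times> real" where
  "U z = z /\<^sub>R golden\<^sup>2 + (1 / golden, 1 / golden)"

definition D_alpha :: "(real \<times> real) set" where
  "D_alpha = U ` D_A"

definition D_beta :: "(real \<times> real) set" where
  "D_beta = U ` D_B"

definition setP :: "(real \<times> real) set" where
  "setP = {z \<in> domD. \<forall>m. T_hat_pow m z \<notin> U ` domD}"

definition hits :: "real \<times> real \<Rightarrow> int set" where
  "hits z = {m. T_hat_pow m z \<in> U ` domD}"

text \<open>The exponent \<open>s z\<close> may be chosen, independently for each \<open>z\<close>, as the least
  nonnegative or as the greatest nonpositive element of \<open>hits z\<close>, whichever exists.\<close>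

definition admissible :: "(real \<times> real \<Rightarrow> int) \<Rightarrow> bool" where
  "admissible s \<longleftrightarrow> (\<forall>z \<in> domD - setP.
     (s z \<in> hits z \<and> s z \<ge> 0 \<and> (\<forall>m \<in> hits z. m \<ge> 0 \<longrightarrow> s z \<le> m)) \<or>
     (s z \<in> hits z \<and> s z \<le> 0 \<and> (\<forall>m \<in> hits z. m \<le> 0 \<longrightarrow> m \<le> s z)))"

definition S :: "(real \<times> real \<Rightarrow> int) \<Rightarrow> real \<times> real \<Rightarrow> real \<times> real" where
  "S s z = inv U (T_hat_pow (s z) z)"

text \<open>\<open>SR s n z\<close> is \<open>S\<^sup>n(R(z))\<close>, with \<open>None\<close> for undefined.\<close>

primrec SR :: "(real \<times> real \<Rightarrow> int) \<Rightarrow> nat \<Rightarrow> real \<times> real \<Rightarrow> (real \<times> real) option" where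
  "SR s 0 z = (if z \<in> unit_square - setR then Some (R z) else None)"
| "SR s (Suc n) z =
     (case SR s n z of
        None \<Rightarrow> None
      | Some w \<Rightarrow> if w \<in> domD - setP then Some (S s w) else None)"

text \<open>The divisions by 3 in the period lengths are exact.\<close>

lemma three_dvd_period_lengths:
  "3 dvd 5 * 4 ^ n + (1 :: nat)" "3 dvd 5 * 4 ^ n - (2 :: nat)"
  by (induction n) (simp_all, presburger+)

end

theory Submission
  imports Defs
begin

text \<open>
  The theorem rests on a renormalisation. On the triangle \<open>domD\<close> the first return map \<open>T_hat\<close>
  of \<open>T\<close> has only two branches, separated by the line \<open>x + golden * y = 2\<close>: strictly above it
  \<open>T_hat = T\<close>, on or below it \<open>T_hat = T ^^ 4\<close>. The similarity \<open>U\<close> maps \<open>domD\<close> onto a smaller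
  triangle in the same corner of the square, and the first return map of \<open>T_hat\<close> to \<open>U ` domD\<close>
  is \<open>T_hat\<close> again, conjugated by \<open>U\<close> (\<open>induces_T_hat_U\<close>). Writing 0 for the upper branch and
  1 for the lower one, the orbit of \<open>U v\<close> follows the word 010 before it returns if \<open>v\<close> is in
  branch 0, and the word 01110 if \<open>v\<close> is in branch 1.

  Being induced is transitive, so the first return map of \<open>T\<close> to \<open>(U ^^ n) ` domD\<close> is a copy of
  \<open>T_hat\<close>, whose return times \<open>a n\<close> and \<open>b n\<close> on the two branches satisfy
  \<open>a (n + 1) = 2 * a n + b n\<close> and \<open>b (n + 1) = 2 * a n + 3 * b n\<close> with \<open>a 0 = 1\<close> and \<open>b 0 = 4\<close>.
  The solution is \<open>a n = (5 * 4 ^ n - 2) / 3\<close> and \<open>b n = 2 * (5 * 4 ^ n + 1) / 3\<close>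
  (\<open>induces_T_U_power\<close>).

  If \<open>w\<close> is the point \<open>S\<^sup>n (R z)\<close>, then \<open>(U ^^ n) w\<close> lies on the two-sided \<open>T\<close>-orbit of \<open>z\<close>,
  because each application of \<open>S\<close> moves along a \<open>T_hat\<close>-orbit into \<open>U ` domD\<close> and rescales.
  As \<open>T\<close> is injective on the square, \<open>z\<close> and \<open>(U ^^ n) w\<close> have the same period
  (\<open>SR_min_period\<close>). It remains to read that period off at the scale of \<open>w\<close>. On \<open>D_alpha\<close> the
  map \<open>T_hat\<close> never leaves the lower branch and acts as an affine map of order 5 with one fixed
  point; the period is therefore \<open>5 * b n\<close>, or \<open>b n\<close> at the fixed point. On \<open>D_beta\<close> the same
  happens in the upper branch with \<open>a n\<close>. If the renormalisation never stops, the two-sided orbit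
  of \<open>z\<close> contains, for each \<open>n\<close>, a point that needs more than \<open>n\<close> steps to return to
  \<open>(U ^^ n) ` domD\<close>, so no period is possible.
\<close>

section \<open>Induced maps\<close>

text \<open>The map \<open>G\<close> on \<open>X\<close> is, through the coding \<open>h\<close>, the first return map of \<open>F\<close> to \<open>h ` X\<close>, and
  \<open>\<tau>\<close> is its return time. Keeping the coding explicit is what lets the same \<open>G\<close> reappear at
  every scale.\<close>

definition induces ::
  "('a \<Rightarrow> 'a) \<Rightarrow> ('b \<Rightarrow> 'a) \<Rightarrow> 'b set \<Rightarrow> ('b \<Rightarrow> 'b) \<Rightarrow> ('b \<Rightarrow> nat) \<Rightarrow> bool" where
  "induces F h X G \<tau> \<longleftrightarrow> inj_on h X \<and>
     (\<forall>v\<in>X. G v \<in> X \<and> 0 < \<tau> v \<and> (F ^^ \<tau> v) (h v) = h (G v) \<and>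
        (\<forall>j. 0 < j \<and> j < \<tau> v \<longrightarrow> (F ^^ j) (h v) \<notin> h ` X))"

lemma induces_orbit:
  assumes "induces F h X G \<tau>" "v \<in> X"
  shows "(G ^^ k) v \<in> X"
  using assms by (induction k) (auto simp: induces_def)

lemma induces_iterate:
  assumes "induces F h X G \<tau>" "v \<in> X"
  shows "(F ^^ (\<Sum>i<k. \<tau> ((G ^^ i) v))) (h v) = h ((G ^^ k) v)"
proof (induction k)
  case (Suc k)
  have "(F ^^ (\<Sum>i<Suc k. \<tau> ((G ^^ i) v))) (h v)
      = (F ^^ \<tau> ((G ^^ k) v)) ((F ^^ (\<Sum>i<k. \<tau> ((G ^^ i) v))) (h v))"
    by (simp add: funpow_add add.commute)
  also have "\<dots> = h (G ((G ^^ k) v))"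
    using Suc induces_orbit[OF assms, of k] assms by (simp add: induces_def)
  finally show ?case by simp
qed simp

text \<open>The only visits of an \<open>F\<close>-orbit to \<open>h ` X\<close> are the accumulated return times: a visit at a
  positive time \<open>j\<close> cannot precede the first return, and the remaining \<open>j - \<tau> v\<close> steps start from
  \<open>h (G v)\<close>.\<close>

lemma induces_hit_times:
  assumes "induces F h X G \<tau>" "v \<in> X" "(F ^^ j) (h v) \<in> h ` X"
  shows "\<exists>k. j = (\<Sum>i<k. \<tau> ((G ^^ i) v))"
  using assms(2,3)
proof (induction j arbitrary: v rule: less_induct)
  case (less j)
  have v: "G v \<in> X" "0 < \<tau> v" "(F ^^ \<tau> v) (h v) = h (G v)"
    using assms(1) less.prems by (auto simp: induces_def)
  show ?case
  proof (cases "j = 0")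
    case True
    then show ?thesis by (intro exI[of _ 0]) simp
  next
    case False
    then have ge: "\<tau> v \<le> j"
      using assms(1) less.prems by (meson induces_def not_le_imp_less zero_less_iff_neq_zero)
    have "(F ^^ (j - \<tau> v)) (h (G v)) = (F ^^ (j - \<tau> v + \<tau> v)) (h v)"
      by (simp only: funpow_add o_apply v)
    then have "(F ^^ (j - \<tau> v)) (h (G v)) \<in> h ` X"
      using ge less.prems by simp
    then obtain k where k: "j - \<tau> v = (\<Sum>i<k. \<tau> ((G ^^ i) (G v)))"
      using less.IH[of "j - \<tau> v" "G v"] v False by auto
    have "(\<Sum>i<Suc k. \<tau> ((G ^^ i) v)) = \<tau> v + (\<Sum>i<k. \<tau> ((G ^^ i) (G v)))"
      by (subst sum.lessThan_Suc_shift) (simp add: funpow_swap1)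
    then show ?thesis using k ge by (intro exI[of _ "Suc k"]) simp
  qed
qed

text \<open>An early visit to the smaller set \<open>(h \<circ> u) ` X\<close> is also a visit to \<open>h ` X\<close>, hence happens at an
  accumulated return time of \<open>G\<close>, and would give an early return of \<open>G\<close> to \<open>u ` X\<close>.\<close>

lemma induces_trans:
  assumes F: "induces F h X G \<tau>" and G: "induces G u X H \<sigma>" and u: "u ` X \<subseteq> X"
  shows "induces F (h \<circ> u) X H (\<lambda>v. \<Sum>i<\<sigma> v. \<tau> ((G ^^ i) (u v)))"
  unfolding induces_def
proof (intro conjI ballI allI impI)
  have injh: "inj_on h X" using F by (simp add: induces_def)
  show "inj_on (h \<circ> u) X"
    using G u injh by (auto simp: induces_def intro: comp_inj_on inj_on_subset)
  fix v assume v: "v \<in> X"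
  then have uv: "u v \<in> X" using u by auto
  have Gv: "H v \<in> X" "0 < \<sigma> v" "(G ^^ \<sigma> v) (u v) = u (H v)"
    and Gno: "\<And>j. 0 < j \<Longrightarrow> j < \<sigma> v \<Longrightarrow> (G ^^ j) (u v) \<notin> u ` X"
    using G v by (auto simp: induces_def)
  have pos: "0 < \<tau> ((G ^^ i) (u v))" for i
    using F induces_orbit[OF F uv] by (auto simp: induces_def)
  show "H v \<in> X" by fact
  show "0 < (\<Sum>i<\<sigma> v. \<tau> ((G ^^ i) (u v)))"
    using Gv(2) pos by (intro sum_pos) auto
  show "(F ^^ (\<Sum>i<\<sigma> v. \<tau> ((G ^^ i) (u v)))) ((h \<circ> u) v) = (h \<circ> u) (H v)"
    using induces_iterate[OF F uv, of "\<sigma> v"] Gv by simp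
  fix j assume j: "0 < j \<and> j < (\<Sum>i<\<sigma> v. \<tau> ((G ^^ i) (u v)))"
  show "(F ^^ j) ((h \<circ> u) v) \<notin> (h \<circ> u) ` X"
  proof
    assume "(F ^^ j) ((h \<circ> u) v) \<in> (h \<circ> u) ` X"
    then obtain x where x: "x \<in> X" "(F ^^ j) (h (u v)) = h (u x)" by auto
    moreover have "u x \<in> X" using u x by auto
    ultimately obtain k where k: "j = (\<Sum>i<k. \<tau> ((G ^^ i) (u v)))"
      using induces_hit_times[OF F uv] by blast
    have "k < \<sigma> v"
    proof (rule ccontr)
      assume "\<not> k < \<sigma> v"
      then have "(\<Sum>i<\<sigma> v. \<tau> ((G ^^ i) (u v))) \<le> j"
        unfolding k by (intro sum_mono2) auto
      then show False using j by simp
    qed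
    moreover have "0 < k" using j k by (cases k) auto
    moreover have "(G ^^ k) (u v) = u x"
      using induces_iterate[OF F uv, of k] k x \<open>u x \<in> X\<close> induces_orbit[OF F uv, of k] injh
      by (auto dest: inj_onD)
    ultimately show False using Gno x by blast
  qed
qed

text \<open>Any time at which \<open>h v\<close> recurs is a visit to \<open>h ` X\<close>, hence a multiple of \<open>c\<close>, and then \<open>G\<close>
  has recurred as well.\<close>

lemma induces_periods_constant:
  assumes F: "induces F h X G \<tau>" and v: "v \<in> X" and c: "\<And>i. \<tau> ((G ^^ i) v) = c"
    and m: "\<And>k. (G ^^ k) v = v \<longleftrightarrow> m dvd k"
  shows "(F ^^ p) (h v) = h v \<longleftrightarrow> m * c dvd p"
proof
  have injh: "inj_on h X" using F by (simp add: induces_def)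
  have it: "(F ^^ (k * c)) (h v) = h ((G ^^ k) v)" for k
    using induces_iterate[OF F v, of k] c by simp
  {
    assume p: "(F ^^ p) (h v) = h v"
    then obtain k where "p = k * c"
      using induces_hit_times[OF F v, of p] v c by auto
    then have "h ((G ^^ k) v) = h v" using it p by simp
    then have "m dvd k"
      using m induces_orbit[OF F v, of k] injh v by (auto dest: inj_onD)
    then show "m * c dvd p" using \<open>p = k * c\<close> by (simp add: mult_dvd_mono)
  }
  assume "m * c dvd p"
  then obtain l where "p = m * c * l" ..
  then have "p = (m * l) * c" by simp
  then show "(F ^^ p) (h v) = h v" using it[of "m * l"] m[of "m * l"] by simp
qed

lemma funpow_fixed: "f x = x \<Longrightarrow> (f ^^ k) x = x"
  by (induction k) auto

text \<open>Since 5 is prime, a recurrence at a time not divisible by 5 would make \<open>x\<close> fixed. The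
  proof uses the inverses 1, 3, 2, 4 of the residues 1, 2, 3, 4 modulo 5.\<close>

lemma funpow_period_five:
  assumes five: "(f ^^ 5) x = x" and nonfix: "f x \<noteq> x"
  shows "(f ^^ k) x = x \<longleftrightarrow> 5 dvd k"
proof
  assume "(f ^^ k) x = x"
  then have r: "(f ^^ (k mod 5)) x = x" using funpow_mod_eq[OF five] by metis
  have "(f ^^ (l * (k mod 5))) x = x" for l
    using funpow_fixed[of "f ^^ (k mod 5)", OF r, of l] by (simp add: funpow_mult mult.commute)
  then have l: "(f ^^ (l * (k mod 5) mod 5)) x = x" for l
    using funpow_mod_eq[OF five] by metis
  have "k mod 5 \<in> {0, 1, 2, 3, 4}" by auto
  then show "5 dvd k"
    using l[of 1] l[of 2] l[of 3] l[of 4] nonfix by auto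
next
  assume "5 dvd k"
  then obtain l where "k = 5 * l" ..
  then show "(f ^^ k) x = x"
    using funpow_fixed[of "f ^^ 5", OF five, of l] by (simp add: funpow_mult)
qed

lemma min_period_eqI:
  assumes "\<And>p. (T ^^ p) z = z \<longleftrightarrow> q dvd p" "0 < q"
  shows "min_period z = enat q"
proof -
  have "(LEAST p. p \<ge> 1 \<and> (T ^^ p) z = z) = q"
    using assms by (intro Least_equality) (auto simp: dvd_imp_le)
  moreover have "\<exists>p\<ge>1. (T ^^ p) z = z"
    using assms by (intro exI[of _ q]) auto
  ultimately show ?thesis by (simp add: min_period_def)
qed

section \<open>The golden ratio and the planar maps\<close>

lemma golden_sq: "golden * golden = golden + 1"
  by (simp add: golden_def field_simps)

text \<open>The companion of \<open>golden_sq\<close> for products that associate to the right; together the two rules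
  reduce every polynomial in \<open>golden\<close> to degree one.\<close>

lemma golden_sq': "golden * (golden * x) = x + golden * x"
  using golden_sq by (metis distrib_right mult.assoc mult_1 add.commute)

lemma golden_gt: "8 / 5 < golden"
proof -
  have "2.2 < sqrt 5" by (rule real_less_rsqrt) (simp add: power2_eq_square)
  then show ?thesis by (simp add: golden_def)
qed

lemma golden_lt: "golden < 81 / 50"
proof -
  have "sqrt 5 < 2.24" by (rule real_less_lsqrt) (simp_all add: power2_eq_square)
  then show ?thesis by (simp add: golden_def)
qed

lemma one_over_golden: "1 / golden = golden - 1"
  using golden_sq golden_gt by (simp add: field_simps)

lemma one_over_golden_sq: "inverse (golden\<^sup>2) = 2 - golden"
  using golden_sq golden_gt
  by (simp add: field_simps power2_eq_square golden_sq')

lemma U_eq: "U (x, y) = ((2 - golden) * x + golden - 1, (2 - golden) * y + golden - 1)"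
  by (simp add: U_def one_over_golden one_over_golden_sq)

lemma inj_U: "inj U"
  using golden_lt by (auto simp: inj_def U_eq)

lemma center_eq: "1 / (golden\<^sup>2 + 1) = (3 - golden) / 5"
  and alpha_center_eq: "golden\<^sup>2 / (golden\<^sup>2 + 1) = (golden + 2) / 5"
proof -
  have ne: "golden\<^sup>2 + 1 \<noteq> 0" using golden_gt by (simp add: power2_eq_square golden_sq)
  then show "1 / (golden\<^sup>2 + 1) = (3 - golden) / 5"
    by (subst frac_eq_eq) (simp_all add: power2_eq_square algebra_simps golden_sq golden_sq')
  show "golden\<^sup>2 / (golden\<^sup>2 + 1) = (golden + 2) / 5"
    using ne by (subst frac_eq_eq) (simp_all add: power2_eq_square algebra_simps golden_sq golden_sq')
qed

lemma multiple_center_eq: "c / (golden\<^sup>2 + 1) = c * (3 - golden) / 5"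
  using center_eq by (metis mult.right_neutral times_divide_eq_right)

lemma domD_iff: "(x, y) \<in> domD \<longleftrightarrow> x < 1 \<and> y < 1 \<and> 3 - golden \<le> x + y"
  using golden_lt by (auto simp: domD_def unit_square_def)

lemma T_eqI:
  fixes c :: int
  assumes "0 \<le> of_int c - x - golden * y" "of_int c - x - golden * y < 1"
  shows "T (x, y) = (y, of_int c - x - golden * y)"
  using assms by (simp add: frac_unique_iff)

lemma T_in_unit_square: "z \<in> unit_square \<Longrightarrow> T z \<in> unit_square"
  by (cases z) (auto simp: unit_square_def frac_lt_1)

text \<open>The second coordinate of the image determines \<open>x\<close> modulo 1, and \<open>x\<close> lies in \<open>[0, 1)\<close>.\<close>

lemma inj_on_T: "inj_on T unit_square"
proof (rule inj_onI, clarify)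
  fix x y x' y' assume z: "(x, y) \<in> unit_square" "(x', y') \<in> unit_square" "T (x, y) = T (x', y')"
  then have "y = y'" and "frac (- x - golden * y) = frac (- x' - golden * y)" by auto
  then obtain k :: int where "x = x' + of_int k"
    by (auto simp: frac_def algebra_simps) (metis add_diff_eq diff_add_cancel of_int_diff)
  moreover have "\<bar>x - x'\<bar> < 1" using z by (auto simp: unit_square_def)
  ultimately show "x = x' \<and> y = y'" using \<open>y = y'\<close> by auto
qed

lemma min_period_T:
  assumes "z \<in> unit_square"
  shows "min_period (T z) = min_period z"
proof -
  have "(T ^^ p) z \<in> unit_square" for p
    using assms T_in_unit_square by (induction p) auto
  then have "(T ^^ p) (T z) = T z \<longleftrightarrow> (T ^^ p) z = z" for p
    using assms inj_on_T by (metis funpow_swap1 inj_on_eq_iff)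
  then show ?thesis by (simp add: min_period_def)
qed

lemma min_period_funpow_T:
  assumes "z \<in> unit_square"
  shows "min_period ((T ^^ p) z) = min_period z"
proof -
  have "(T ^^ p) z \<in> unit_square" for p
    using assms T_in_unit_square by (induction p) auto
  then show ?thesis by (induction p) (auto simp: min_period_T)
qed

section \<open>The first return map to the triangle\<close>

lemma T_hat_eqI:
  assumes "(T ^^ Suc k) z \<in> domD" "\<And>j. j < k \<Longrightarrow> (T ^^ Suc j) z \<notin> domD"
  shows "T_hat z = (T ^^ Suc k) z"
proof -
  have "r (T z) = k"
    unfolding r_def using assms
    by (intro Least_equality) (auto simp: funpow_swap1 intro: leI)
  then show ?thesis by (simp add: T_hat_def R_def funpow_swap1)
qed

text \<open>Strictly above the line the integer added by \<open>T\<close> is 3 and one step already returns.\<close>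

lemma T_upper:
  assumes "(x, y) \<in> domD" "x + golden * y > 2"
  shows "T (x, y) = (y, 3 - x - golden * y)" "(y, 3 - x - golden * y) \<in> domD"
proof -
  have 1: "x < 1" "y < 1" "3 - golden \<le> x + y" using assms by (auto simp: domD_iff)
  have 2: "golden * y \<le> golden" "(golden - 1) * y \<le> golden - 1"
    using 1 golden_gt by auto
  show "T (x, y) = (y, 3 - x - golden * y)"
  proof -
    have "x + golden * y \<le> 3" using 1 2 golden_lt by linarith
    then show ?thesis using T_eqI[of 3 x y] assms by simp
  qed
  show "(y, 3 - x - golden * y) \<in> domD"
    using 1 2 assms by (simp add: domD_iff algebra_simps)
qed

text \<open>On or below the line the added integers are 2, 1, 1, 2 in this order. Since the fifth power of
  the matrix is the identity, the fourth iterate has linear part equal to its inverse; this is why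
  the final point has \<open>x\<close> as its second coordinate. The
  inequalities of the triangle and of the branch determine the four integers; the estimates combine
  them after multiplication by \<open>golden\<close>, \<open>golden - 1\<close> or \<open>2 - golden\<close>.\<close>

lemma T_lower:
  assumes "(x, y) \<in> domD" "x + golden * y \<le> 2"
  shows "T (x, y) = (y, 2 - x - golden * y)"
    "(T ^^ 2) (x, y) = (2 - x - golden * y, 1 - 2 * golden + golden * (x + y))"
    "(T ^^ 3) (x, y) = (1 - 2 * golden + golden * (x + y), golden + 1 - golden * x - y)"
    "(T ^^ 4) (x, y) = (golden + 1 - golden * x - y, x)"
    "T (x, y) \<notin> domD" "(T ^^ 2) (x, y) \<notin> domD" "(T ^^ 3) (x, y) \<notin> domD"
    "(golden + 1 - golden * x - y, x) \<in> domD"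
proof -
  have 1: "x < 1" "y < 1" "3 - golden \<le> x + y" using assms by (auto simp: domD_iff)
  note g = golden_gt golden_lt
  have x: "x > 2 - golden" and y: "y > 2 - golden" using 1 by auto
  have a: "golden * y \<ge> y" using y g by simp
  have b: "(2 - golden) * y \<le> 2 - golden" using 1 g by simp
  have c: "golden * (3 - golden) \<le> golden * (x + y)" using 1 g by (intro mult_left_mono) auto
  have d: "golden * x < golden" "golden * y < golden" using 1 g by auto
  have e: "(golden - 1) * x > (golden - 1) * (2 - golden)"
    using x g by (intro mult_strict_left_mono) auto
  have f: "(golden - 1) * (x + golden * y) \<le> (golden - 1) * 2"
    using assms g by (intro mult_left_mono) auto
  show T1: "T (x, y) = (y, 2 - x - golden * y)"
    using T_eqI[of 2 x y] 1 a g assms by simp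
  have T2: "T (y, 2 - x - golden * y) = (2 - x - golden * y, 1 - 2 * golden + golden * (x + y))"
    using T_eqI[of 1 y "2 - x - golden * y"] 1 c d g
    by (simp add: algebra_simps golden_sq golden_sq')
  have T3: "T (2 - x - golden * y, 1 - 2 * golden + golden * (x + y))
      = (1 - 2 * golden + golden * (x + y), golden + 1 - golden * x - y)"
    using T_eqI[of 1 "2 - x - golden * y" "1 - 2 * golden + golden * (x + y)"] 1 d e g
    by (simp add: algebra_simps golden_sq golden_sq')
  have T4: "T (1 - 2 * golden + golden * (x + y), golden + 1 - golden * x - y)
      = (golden + 1 - golden * x - y, x)"
    using T_eqI[of 2 "1 - 2 * golden + golden * (x + y)" "golden + 1 - golden * x - y"] 1 x g
    by (simp add: algebra_simps golden_sq golden_sq')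
  show P2: "(T ^^ 2) (x, y) = (2 - x - golden * y, 1 - 2 * golden + golden * (x + y))"
    by (simp only: numeral_eq_Suc pred_numeral_simps BitM.simps funpow.simps o_apply id_apply T1 T2)
  show P3: "(T ^^ 3) (x, y) = (1 - 2 * golden + golden * (x + y), golden + 1 - golden * x - y)"
    using P2 T3 by (simp add: eval_nat_numeral del: T.simps)
  show "(T ^^ 4) (x, y) = (golden + 1 - golden * x - y, x)"
    using P3 T4 by (simp add: eval_nat_numeral del: T.simps)
  show "T (x, y) \<notin> domD" unfolding T1
    using 1 b g by (simp add: domD_iff algebra_simps)
  show "(T ^^ 2) (x, y) \<notin> domD" unfolding P2
    using 1 e g mult_strict_left_mono[of x 1 "golden - 1"] by (simp add: domD_iff algebra_simps)
  show "(T ^^ 3) (x, y) \<notin> domD" unfolding P3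
    using 1 g mult_strict_left_mono[of y 1 "golden - 1"] by (simp add: domD_iff algebra_simps)
  show "(golden + 1 - golden * x - y, x) \<in> domD"
    using 1 e f by (simp add: domD_iff algebra_simps golden_sq golden_sq')
qed

text \<open>The branch of \<open>T_hat\<close> on which \<open>T_hat = T\<close>.\<close>

definition upper :: "real \<times> real \<Rightarrow> bool" where
  "upper v \<longleftrightarrow> fst v + golden * snd v > 2"

lemma T_hat_upper:
  assumes "(x, y) \<in> domD" "upper (x, y)"
  shows "T_hat (x, y) = (y, 3 - x - golden * y)"
  using T_hat_eqI[of 0 "(x, y)"] T_upper[of x y] assms by (simp add: upper_def del: T.simps)

lemma T_hat_lower:
  assumes "(x, y) \<in> domD" "\<not> upper (x, y)"
  shows "T_hat (x, y) = (golden + 1 - golden * x - y, x)" "T_hat (x, y) = (T ^^ 4) (x, y)"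
    "\<And>j. 0 < j \<Longrightarrow> j < 4 \<Longrightarrow> (T ^^ j) (x, y) \<notin> domD"
proof -
  note T = T_lower[of x y]
  show not: "(T ^^ j) (x, y) \<notin> domD" if "0 < j" "j < 4" for j
  proof -
    from that have "j \<in> {1, 2, 3}" by auto
    then show ?thesis using T assms by (auto simp: upper_def simp del: T.simps)
  qed
  show "T_hat (x, y) = (T ^^ 4) (x, y)"
    using T_hat_eqI[of 3 "(x, y)"] not[of "Suc _"] T(4,8) assms
    by (simp add: upper_def del: T.simps funpow.simps)
  then show "T_hat (x, y) = (golden + 1 - golden * x - y, x)"
    using T(4) assms by (simp add: upper_def del: T.simps)
qed

lemma T_hat_in_domD: "v \<in> domD \<Longrightarrow> T_hat v \<in> domD"
  by (cases v; cases "upper v")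
     (auto simp: T_hat_upper T_hat_lower(1) T_upper(2) T_lower(8) upper_def simp del: T.simps)

text \<open>\<open>T\<close> is reversible: exchanging the coordinates turns it into its inverse, and \<open>domD\<close> is
  symmetric. A preimage of \<open>w\<close> is thus found by applying \<open>T_hat\<close> to the reflected point and
  reflecting back.\<close>

lemma T_hat_surj:
  assumes "w \<in> domD"
  shows "w \<in> T_hat ` domD"
proof -
  obtain x y where w: "w = (x, y)" by (cases w)
  have swapped: "(y, x) \<in> domD" using assms by (auto simp: w domD_iff)
  show ?thesis
  proof (cases "upper (y, x)")
    case True
    have "(3 - y - golden * x, x) \<in> domD"
      using T_hat_in_domD[OF swapped] T_hat_upper[OF swapped True] by (auto simp: domD_iff)
    moreover from this have "T_hat (3 - y - golden * x, x) = w"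
      using assms by (subst T_hat_upper) (auto simp: w upper_def domD_iff)
    ultimately show ?thesis by (metis image_eqI)
  next
    case False
    have "(y, golden + 1 - golden * y - x) \<in> domD"
      using T_hat_in_domD[OF swapped] T_hat_lower(1)[OF swapped False] by (auto simp: domD_iff)
    moreover have "\<not> upper (y, golden + 1 - golden * y - x)"
    proof -
      have "golden * (3 - golden) \<le> golden * (x + y)"
        using assms golden_gt by (intro mult_left_mono) (auto simp: w domD_iff)
      then show ?thesis by (simp add: upper_def algebra_simps golden_sq golden_sq')
    qed
    ultimately have "T_hat (y, golden + 1 - golden * y - x) = w"
      by (simp add: w T_hat_lower(1))
    moreover note \<open>(y, golden + 1 - golden * y - x) \<in> domD\<close>
    ultimately show ?thesis by (metis image_eqI)
  qed
qed

section \<open>Self-similarity\<close>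

lemma U_domD_subset: "U ` domD \<subseteq> domD"
proof (rule image_subsetI, clarify)
  fix x y assume "(x, y) \<in> domD"
  then have 1: "x < 1" "y < 1" "3 - golden \<le> x + y" by (auto simp: domD_iff)
  have "(2 - golden) * x < 2 - golden" "(2 - golden) * y < 2 - golden"
    "(2 - golden) * (3 - golden) \<le> (2 - golden) * (x + y)"
    using 1 golden_lt by simp_all
  then show "U (x, y) \<in> domD"
    using golden_lt by (simp add: U_eq domD_iff algebra_simps golden_sq golden_sq')
qed

lemma U_domD_bounds:
  assumes "(a, b) \<in> U ` domD"
  shows "golden - 1 \<le> a" "golden - 1 \<le> b" "5 - 2 * golden \<le> a + b" "a < 1" "b < 1"
proof -
  obtain x y where xy: "(x, y) \<in> domD" "U (x, y) = (a, b)" using assms by force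
  then have 1: "x < 1" "y < 1" "3 - golden \<le> x + y" by (auto simp: domD_iff)
  then have "0 \<le> x" "0 \<le> y" using golden_lt by auto
  then have "0 \<le> (2 - golden) * x" "0 \<le> (2 - golden) * y" using golden_lt by simp_all
  then show "golden - 1 \<le> a" "golden - 1 \<le> b" using xy by (auto simp: U_eq)
  have "(2 - golden) * (3 - golden) \<le> (2 - golden) * (x + y)" using 1 golden_lt by simp
  then show "5 - 2 * golden \<le> a + b"
    using xy by (auto simp: U_eq algebra_simps golden_sq golden_sq')
  show "a < 1" "b < 1" using U_domD_subset assms by (auto simp: domD_iff subset_iff)
qed

text \<open>The image under \<open>U\<close> of the line that separates the two branches is the parallel line
  \<open>a + golden * b = 4 - golden\<close>.\<close>

lemma upper_U_iff: "fst (U v) + golden * snd (U v) > 4 - golden \<longleftrightarrow> upper v"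
proof (cases v)
  case (Pair x y)
  have "fst (U v) + golden * snd (U v) - (4 - golden) = (2 - golden) * (x + golden * y - 2)"
    by (simp add: Pair U_eq algebra_simps golden_sq golden_sq')
  moreover have "(2 - golden) * (x + golden * y - 2) > 0 \<longleftrightarrow> x + golden * y - 2 > 0"
    using golden_lt by (simp add: zero_less_mult_iff)
  ultimately show ?thesis unfolding Pair upper_def fst_conv snd_conv by linarith
qed

text \<open>The letters 0 and 1 common to the words 010 and 01110. After two steps the point has only been
  translated by \<open>golden - 2\<close> to the left. This translation carries the separating line of \<open>upper_U_iff\<close> to
  the line \<open>x + golden * y = 2\<close>, so the third letter is the branch of \<open>v\<close>.\<close>

lemma T_hat_U_start:
  assumes v: "v \<in> domD" and ab: "U v = (a, b)"
  shows "upper (a, b)" "T_hat (a, b) = (b, 3 - a - golden * b)"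
    "\<not> upper (b, 3 - a - golden * b)" "(T_hat ^^ 2) (a, b) = (a + golden - 2, b)"
    "(b, 3 - a - golden * b) \<notin> U ` domD" "(a + golden - 2, b) \<notin> U ` domD"
    "(a + golden - 2, b) \<in> domD" "upper (a + golden - 2, b) \<longleftrightarrow> upper v"
proof -
  have D: "(a, b) \<in> domD" using U_domD_subset v ab by force
  have bd: "golden - 1 \<le> a" "golden - 1 \<le> b" "5 - 2 * golden \<le> a + b" "a < 1" "b < 1"
    using U_domD_bounds[of a b] v ab by (force intro: rev_image_eqI)+
  have "(golden - 1) * (4 - 2 * golden) \<le> (golden - 1) * b"
    using bd golden_gt by (intro mult_left_mono) auto
  then show up: "upper (a, b)"
    using bd golden_gt by (simp add: upper_def algebra_simps golden_sq golden_sq')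
  show h1: "T_hat (a, b) = (b, 3 - a - golden * b)" using T_hat_upper[OF D up] .
  have "golden * (5 - 2 * golden) \<le> golden * (a + b)"
    using bd golden_gt by (intro mult_left_mono) auto
  then show low: "\<not> upper (b, 3 - a - golden * b)"
    by (simp add: upper_def algebra_simps golden_sq golden_sq')
  have h2: "T_hat (b, 3 - a - golden * b) = (a + golden - 2, b)"
    using T_hat_lower(1)[OF _ low] T_hat_in_domD[OF D]
    by (simp add: h1 algebra_simps golden_sq golden_sq')
  show "(T_hat ^^ 2) (a, b) = (a + golden - 2, b)"
    by (simp add: eval_nat_numeral h1 h2)
  show "(a + golden - 2, b) \<in> domD"
    using T_hat_in_domD[OF T_hat_in_domD[OF D]] by (simp add: h1 h2)
  have "(2 - golden) * b \<le> 2 - golden" using bd golden_lt by simp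
  then show "(b, 3 - a - golden * b) \<notin> U ` domD"
    using U_domD_bounds(3)[of b "3 - a - golden * b"] bd golden_lt
    by (auto simp: algebra_simps)
  show "(a + golden - 2, b) \<notin> U ` domD"
    using U_domD_bounds(1)[of "a + golden - 2" b] bd by auto
  show "upper (a + golden - 2, b) \<longleftrightarrow> upper v"
    using upper_U_iff[of v] by (auto simp: ab upper_def)
qed

lemma T_hat_U_upper:
  assumes v: "v \<in> domD" and up: "upper v"
  shows "(T_hat ^^ 3) (U v) = U (T_hat v)"
proof -
  obtain x y a b where xy: "v = (x, y)" and ab: "U v = (a, b)" by (meson surj_pair)
  note st = T_hat_U_start[OF v ab]
  have "(T_hat ^^ 3) (U v) = T_hat ((T_hat ^^ 2) (a, b))"
    by (simp add: ab eval_nat_numeral)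
  also have "\<dots> = (b, 5 - golden - a - golden * b)"
    unfolding st(4) using T_hat_upper[OF st(7)] up st(8) by simp
  also have "\<dots> = U (T_hat v)"
  proof -
    have ab': "a = (2 - golden) * x + golden - 1" "b = (2 - golden) * y + golden - 1"
      using ab by (simp_all add: xy U_eq)
    have h: "T_hat v = (y, 3 - x - golden * y)"
      using T_hat_upper[of x y] v up by (simp add: xy)
    show ?thesis by (simp add: h ab' U_eq algebra_simps golden_sq golden_sq')
  qed
  finally show ?thesis .
qed

lemma T_hat_U_lower:
  assumes v: "v \<in> domD" and low: "\<not> upper v"
  shows "\<not> upper ((T_hat ^^ 3) (U v))" "upper ((T_hat ^^ 4) (U v))"
    "(T_hat ^^ 3) (U v) \<notin> U ` domD" "(T_hat ^^ 4) (U v) \<notin> U ` domD"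
    "(T_hat ^^ 5) (U v) = U (T_hat v)"
proof -
  obtain x y a b where xy: "v = (x, y)" and ab: "U v = (a, b)" by (meson surj_pair)
  note st = T_hat_U_start[OF v ab]
  have bd: "golden - 1 \<le> a" "golden - 1 \<le> b" "5 - 2 * golden \<le> a + b" "a < 1" "b < 1"
    using U_domD_bounds[of a b] v ab by (force intro: rev_image_eqI)+
  have h3: "T_hat (a + golden - 2, b) = (2 * golden - golden * a - b, a + golden - 2)"
    using T_hat_lower(1)[OF st(7)] low st(8) by (simp add: algebra_simps golden_sq)
  then have D3: "(2 * golden - golden * a - b, a + golden - 2) \<in> domD"
    using T_hat_in_domD[OF st(7)] by simp
  have low3: "\<not> upper (2 * golden - golden * a - b, a + golden - 2)"
    using bd by (simp add: upper_def algebra_simps golden_sq)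
  have h4: "T_hat (2 * golden - golden * a - b, a + golden - 2)
      = (1 - 2 * golden + golden * (a + b), 2 * golden - golden * a - b)"
    using T_hat_lower(1)[OF D3 low3] by (simp add: algebra_simps golden_sq golden_sq')
  then have D4: "(1 - 2 * golden + golden * (a + b), 2 * golden - golden * a - b) \<in> domD"
    using T_hat_in_domD[OF D3] by simp
  have up4: "upper (1 - 2 * golden + golden * (a + b), 2 * golden - golden * a - b)"
    using bd by (simp add: upper_def algebra_simps golden_sq golden_sq')
  have h5: "T_hat (1 - 2 * golden + golden * (a + b), 2 * golden - golden * a - b)
      = (2 * golden - golden * a - b, a)"
    using T_hat_upper[OF D4 up4] by (simp add: algebra_simps golden_sq golden_sq')
  have P3: "(T_hat ^^ 3) (U v) = (2 * golden - golden * a - b, a + golden - 2)"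
    using st(4) by (simp add: ab eval_nat_numeral h3)
  then have P4: "(T_hat ^^ 4) (U v)
      = (1 - 2 * golden + golden * (a + b), 2 * golden - golden * a - b)"
    by (simp add: eval_nat_numeral h4)
  then have P5: "(T_hat ^^ 5) (U v) = (2 * golden - golden * a - b, a)"
    by (simp add: eval_nat_numeral h5)
  show "\<not> upper ((T_hat ^^ 3) (U v))" "upper ((T_hat ^^ 4) (U v))"
    unfolding P3 P4 by (fact low3 up4)+
  show "(T_hat ^^ 3) (U v) \<notin> U ` domD"
    unfolding P3 using U_domD_bounds(2) bd by force
  have "(golden - 1) * b \<le> golden - 1" using bd golden_gt by simp
  then show "(T_hat ^^ 4) (U v) \<notin> U ` domD"
    unfolding P4
    using U_domD_bounds(3)[of "1 - 2 * golden + golden * (a + b)" "2 * golden - golden * a - b"]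
      golden_lt by (auto simp: algebra_simps)
  show "(T_hat ^^ 5) (U v) = U (T_hat v)"
  proof -
    have ab': "a = (2 - golden) * x + golden - 1" "b = (2 - golden) * y + golden - 1"
      using ab by (simp_all add: xy U_eq)
    have h: "T_hat v = (golden + 1 - golden * x - y, x)"
      using T_hat_lower(1)[of x y] v low by (simp add: xy)
    show ?thesis unfolding P5 by (simp add: h ab' U_eq algebra_simps golden_sq golden_sq')
  qed
qed

text \<open>Points \<open>(a, b)\<close> of \<open>U ` domD\<close> satisfy \<open>a \<ge> golden - 1\<close>, \<open>b \<ge> golden - 1\<close> and
  \<open>a + b \<ge> 5 - 2 * golden\<close>. The intermediate points of the orbit of \<open>U v\<close> violate, in turn, the
  third, the first, the second and the third of these inequalities.\<close>

lemma induces_T_hat_U: "induces T_hat U domD T_hat (\<lambda>v. if upper v then 3 else 5)"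
  unfolding induces_def
proof (intro conjI ballI allI impI)
  show "inj_on U domD" using inj_U by (rule inj_on_subset) simp
  fix v assume v: "v \<in> domD"
  obtain a b where ab: "U v = (a, b)" by (meson surj_pair)
  note st = T_hat_U_start[OF v ab]
  show "T_hat v \<in> domD" using T_hat_in_domD[OF v] .
  show "(0::nat) < (if upper v then 3 else 5)" by simp
  show "(T_hat ^^ (if upper v then 3 else 5)) (U v) = U (T_hat v)"
    using T_hat_U_upper[OF v] T_hat_U_lower(5)[OF v] by simp
  fix j :: nat assume j: "0 < j \<and> j < (if upper v then 3 else 5)"
  then have "j = 1 \<or> j = 2 \<or> \<not> upper v \<and> (j = 3 \<or> j = 4)" by (auto split: if_splits)
  then show "(T_hat ^^ j) (U v) \<notin> U ` domD"
    by (elim disjE conjE) (simp_all add: ab st(2,4,5,6) T_hat_U_lower(3,4)[OF v, unfolded ab])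
qed

text \<open>The return time of \<open>T\<close> to \<open>(U ^^ n) ` domD\<close> at \<open>(U ^^ n) v\<close>, in closed form.\<close>

definition return_time :: "nat \<Rightarrow> real \<times> real \<Rightarrow> nat" where
  "return_time n v = (if upper v then (5 * 4 ^ n - 2) div 3 else 2 * (5 * 4 ^ n + 1) div 3)"

lemma period_length_recurrences:
  "(5 * 4 ^ Suc n - 2) div 3 = 2 * ((5 * 4 ^ n - 2) div 3) + 2 * (5 * 4 ^ n + 1) div (3::nat)"
  "2 * (5 * 4 ^ Suc n + 1) div 3
     = 2 * ((5 * 4 ^ n - 2) div 3) + 3 * (2 * (5 * 4 ^ n + 1) div (3::nat))"
proof -
  have "\<exists>k. (4::nat) ^ n = 3 * k + 1"
    by (induction n) (auto, presburger)
  then obtain k where "(4::nat) ^ n = 3 * k + 1" ..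
  then have "5 * (4::nat) ^ Suc n - 2 = (20 * k + 6) * 3" "2 * (5 * (4::nat) ^ Suc n + 1) = (40 * k + 14) * 3"
    "5 * (4::nat) ^ n - 2 = (5 * k + 1) * 3" "2 * (5 * (4::nat) ^ n + 1) = (10 * k + 4) * 3"
    by simp_all
  then show "(5 * 4 ^ Suc n - 2) div 3
        = 2 * ((5 * 4 ^ n - 2) div 3) + 2 * (5 * 4 ^ n + 1) div (3::nat)"
    "2 * (5 * 4 ^ Suc n + 1) div 3
        = 2 * ((5 * 4 ^ n - 2) div 3) + 3 * (2 * (5 * 4 ^ n + 1) div (3::nat))"
    by (simp_all only: nonzero_mult_div_cancel_right) simp_all
qed

lemma return_time_ge: "n < return_time n v"
proof -
  have "n < (4::nat) ^ n" by (induction n) auto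
  moreover have "n < (5 * m - 2) div 3" "n < 2 * (5 * m + 1) div 3" if "n < m" for m :: nat
    using that div_le_mono[of "3 * (n + 1)" "5 * m - 2" 3] div_le_mono[of "3 * (n + 1)" "2 * (5 * m + 1)" 3]
    by auto
  ultimately show ?thesis by (simp add: return_time_def)
qed

text \<open>The words 010 and 01110 contain two letters 0 and one letter 1, respectively two letters 0 and
  three letters 1.\<close>

lemma return_time_Suc:
  assumes v: "v \<in> domD"
  shows "(\<Sum>i<(if upper v then 3 else 5). return_time n ((T_hat ^^ i) (U v))) = return_time (Suc n) v"
proof -
  obtain a b where ab: "U v = (a, b)" by (meson surj_pair)
  note st = T_hat_U_start[OF v ab]
  have "upper (U v)" "\<not> upper (T_hat (U v))" "upper ((T_hat ^^ 2) (U v)) \<longleftrightarrow> upper v"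
    using st by (auto simp: ab)
  moreover have "\<not> upper v \<Longrightarrow> \<not> upper ((T_hat ^^ 3) (U v)) \<and> upper ((T_hat ^^ 4) (U v))"
    using T_hat_U_lower[OF v] by simp
  moreover have "{..<3::nat} = {0, 1, 2}" "{..<5::nat} = {0, 1, 2, 3, 4}" by auto
  ultimately show ?thesis
    by (cases "upper v") (simp_all only: return_time_def if_True if_False period_length_recurrences, simp_all)
qed

lemma induces_cong:
  "induces F h X G \<tau> \<Longrightarrow> (\<And>v. v \<in> X \<Longrightarrow> \<tau> v = \<sigma> v) \<Longrightarrow> induces F h X G \<sigma>"
  by (simp add: induces_def)

lemma induces_T_U_power: "induces T (U ^^ n) domD T_hat (return_time n)"
proof (induction n)
  case 0
  show ?case
    using T_hat_in_domD T_hat_lower(2,3) T_upper(1) T_hat_upper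
    by (auto simp: induces_def return_time_def upper_def simp del: T.simps)
next
  case (Suc n)
  show ?case
    using induces_cong[OF induces_trans[OF Suc induces_T_hat_U U_domD_subset] return_time_Suc]
    by (simp only: funpow_Suc_right)
qed

section \<open>Periods along the renormalised orbit\<close>

lemma U_power_in_domD: "v \<in> domD \<Longrightarrow> (U ^^ n) v \<in> domD"
  using U_domD_subset by (induction n) auto

lemma domD_subset: "domD \<subseteq> unit_square"
  by (auto simp: domD_def)

lemma min_period_T_hat:
  assumes "v \<in> domD"
  shows "min_period ((U ^^ n) (T_hat v)) = min_period ((U ^^ n) v)"
proof -
  have "(U ^^ n) (T_hat v) = (T ^^ return_time n v) ((U ^^ n) v)"
    using induces_T_U_power[of n] assms by (simp add: induces_def)
  then show ?thesis
    using min_period_funpow_T[of "(U ^^ n) v"] U_power_in_domD[OF assms, of n] domD_subset by auto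
qed

text \<open>For negative exponents, surjectivity of \<open>T_hat\<close> makes \<open>inv_into\<close> a right inverse, and each
  backward step is undone by a forward step that preserves the period.\<close>

lemma min_period_T_hat_pow:
  assumes "v \<in> domD"
  shows "min_period ((U ^^ n) (T_hat_pow m v)) = min_period ((U ^^ n) v)"
proof -
  define I where "I = inv_into domD T_hat"
  have I: "I w \<in> domD" "T_hat (I w) = w" if "w \<in> domD" for w
    using T_hat_surj[OF that] by (auto simp: I_def inv_into_into f_inv_into_f)
  have fwd: "(T_hat ^^ k) v \<in> domD \<and> min_period ((U ^^ n) ((T_hat ^^ k) v)) = min_period ((U ^^ n) v)" for k
    using assms by (induction k) (auto simp: T_hat_in_domD min_period_T_hat)
  have bwd: "(I ^^ k) v \<in> domD \<and> min_period ((U ^^ n) ((I ^^ k) v)) = min_period ((U ^^ n) v)" for k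
  proof (induction k)
    case (Suc k)
    then show ?case using I[of "(I ^^ k) v"] min_period_T_hat[of "I ((I ^^ k) v)" n] by simp
  qed (use assms in simp)
  show ?thesis using fwd bwd by (simp add: T_hat_pow_def I_def)
qed

text \<open>One application of \<open>S\<close> replaces \<open>v\<close> by the point \<open>w\<close> with \<open>U w\<close> on the \<open>T_hat\<close>-orbit of \<open>v\<close>.
  This holds for both admissible choices of \<open>s v\<close>, as each is a time at which that orbit is in
  \<open>U ` domD\<close>.\<close>

lemma SR_min_period:
  assumes s: "admissible s" and z: "z \<in> unit_square" and w: "SR s n z = Some w"
  shows "w \<in> domD \<and> min_period z = min_period ((U ^^ n) w)"
  using w
proof (induction n arbitrary: w)
  case 0
  then have "z \<in> unit_square - setR" "w = R z" by (auto split: if_splits)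
  then obtain m where "(T ^^ m) z \<in> domD" by (auto simp: setR_def)
  then have "R z \<in> domD" unfolding R_def r_def by (rule LeastI)
  then show ?case using \<open>w = R z\<close> min_period_funpow_T[OF z] by (simp add: R_def)
next
  case (Suc n)
  then obtain v where v: "SR s n z = Some v" "v \<in> domD - setP" "w = S s v"
    by (auto split: option.splits if_splits)
  then have "s v \<in> hits v" using s by (auto simp: admissible_def)
  then obtain x where x: "x \<in> domD" "T_hat_pow (s v) v = U x" by (auto simp: hits_def)
  then have "w = x" using v inj_U by (simp add: S_def inv_f_f)
  then have "(U ^^ Suc n) w = (U ^^ n) (T_hat_pow (s v) v)"
    using x by (simp add: funpow_swap1)
  then show ?case
    using Suc.IH[OF v(1)] min_period_T_hat_pow[of v n "s v"] x \<open>w = x\<close> by simp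
qed

text \<open>While the \<open>T_hat\<close>-orbit of \<open>v\<close> stays in one branch, each step of it costs the same number of
  steps of \<open>T\<close> at scale \<open>n\<close>.\<close>

lemma min_period_U_power:
  assumes v: "v \<in> domD" and up: "\<And>i. upper ((T_hat ^^ i) v) \<longleftrightarrow> upper v"
    and five: "(T_hat ^^ 5) v = v"
  shows "min_period ((U ^^ n) v) = enat ((if T_hat v = v then 1 else 5) * return_time n v)"
proof (rule min_period_eqI)
  have "(T_hat ^^ k) v = v \<longleftrightarrow> (if T_hat v = v then 1 else 5) dvd k" for k
    using funpow_period_five[OF five] funpow_fixed[of T_hat v] by simp
  then show "(T ^^ p) ((U ^^ n) v) = (U ^^ n) v
      \<longleftrightarrow> (if T_hat v = v then 1 else 5) * return_time n v dvd p" for p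
    using induces_periods_constant[OF induces_T_U_power v, of n "return_time n v"] up
    by (simp add: return_time_def)
  show "0 < (if T_hat v = v then 1 else 5) * return_time n v"
    using return_time_ge[of n v] by simp
qed

text \<open>A period \<open>p\<close> would bring a point of \<open>(U ^^ p) ` domD\<close> back at time \<open>p\<close>, before its first
  return time at that scale.\<close>

lemma min_period_infinite:
  assumes "\<And>n. \<exists>v\<in>domD. min_period z = min_period ((U ^^ n) v)"
  shows "min_period z = \<infinity>"
proof (cases "min_period z")
  case (enat p)
  obtain v where v: "v \<in> domD" "min_period ((U ^^ p) v) = enat p" using assms enat by metis
  then have ex: "\<exists>q\<ge>1. (T ^^ q) ((U ^^ p) v) = (U ^^ p) v"
    and p: "p = (LEAST q. q \<ge> 1 \<and> (T ^^ q) ((U ^^ p) v) = (U ^^ p) v)"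
    by (auto simp: min_period_def split: if_splits)
  have "p \<ge> 1 \<and> (T ^^ p) ((U ^^ p) v) = (U ^^ p) v"
    using LeastI_ex[OF ex[unfolded Bex_def]] p by metis
  moreover have "p < return_time p v" by (rule return_time_ge)
  ultimately have "(U ^^ p) v \<notin> (U ^^ p) ` domD"
    using induces_T_U_power[of p] v(1) unfolding induces_def by (metis less_eq_Suc_le One_nat_def)
  then show ?thesis using v(1) by simp
qed simp

section \<open>The rotation domains\<close>

text \<open>The matrix has trace \<open>- golden\<close> and determinant 1, so it is conjugate to a rotation of order 5,
  and so is every affine map with this linear part.\<close>

lemma rotation_orbit:
  assumes "\<And>k. (T ^^ Suc k) z = mult_A ((T ^^ k) z) + (0, c)" and z: "z = (x, y)"
  shows "T z = (y, c - x - golden * y)"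
    "(T ^^ 3) z = (c - c * golden + golden * (x + y), c - golden * x - y)"
    "(T ^^ 4) z = (c - golden * x - y, x)" "(T ^^ 5) z = z"
proof -
  note step = assms(1)[of 0] assms(1)[of 1] assms(1)[of 2] assms(1)[of 3] assms(1)[of 4]
  show 1: "T z = (y, c - x - golden * y)" using step(1) by (simp add: z del: T.simps)
  have "(T ^^ 2) z = (c - x - golden * y, c - c * golden + golden * (x + y))"
    using step(2) by (simp add: 1 eval_nat_numeral algebra_simps golden_sq golden_sq' del: T.simps)
  then show 3: "(T ^^ 3) z = (c - c * golden + golden * (x + y), c - golden * x - y)"
    using step(3) by (simp add: eval_nat_numeral algebra_simps golden_sq golden_sq' del: T.simps)
  then show 4: "(T ^^ 4) z = (c - golden * x - y, x)"
    using step(4) by (simp add: eval_nat_numeral algebra_simps golden_sq golden_sq' del: T.simps)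
  then show "(T ^^ 5) z = z"
    using step(5) by (simp add: z eval_nat_numeral algebra_simps del: T.simps)
qed

lemma rotation_fixed_iff:
  assumes "T (x, y) = (y, c - x - golden * y)"
  shows "T (x, y) = (x, y) \<longleftrightarrow> (x, y) = (c / (golden\<^sup>2 + 1), c / (golden\<^sup>2 + 1))"
proof -
  have "golden\<^sup>2 + 1 = golden + 2" by (simp add: power2_eq_square golden_sq)
  moreover have "T (x, y) = (x, y) \<longleftrightarrow> x = y \<and> (golden + 2) * x = c"
    unfolding assms by (auto simp: algebra_simps)
  ultimately show ?thesis using golden_gt by (auto simp: eq_divide_eq mult.commute)
qed

text \<open>\<open>T\<close> fixes \<open>(t, t)\<close> when \<open>t + t + golden * t = (golden\<^sup>2 + 1) * t\<close> is an integer. The value 0 of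
  this integer gives the corner, which is outside \<open>D_A\<close> and \<open>D_B\<close>.\<close>

lemma T_center:
  assumes "c \<in> {0, 1, 2}"
  shows "T (c / (golden\<^sup>2 + 1), c / (golden\<^sup>2 + 1)) = (c / (golden\<^sup>2 + 1), c / (golden\<^sup>2 + 1))"
proof -
  obtain k :: int where k: "c = of_int k" using assms by (metis insert_iff of_int_0 of_int_1 of_int_numeral empty_iff)
  have eq: "c - c * (3 - golden) / 5 - golden * (c * (3 - golden) / 5) = c * (3 - golden) / 5"
    by (simp add: field_simps golden_sq golden_sq')
  have "0 \<le> c * (3 - golden) / 5" "c * (3 - golden) / 5 < 1"
    using assms golden_lt golden_gt by auto
  then show ?thesis
    unfolding multiple_center_eq[of c]
    using T_eqI[of k "c * (3 - golden) / 5" "c * (3 - golden) / 5", folded k] eq by simp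
qed

lemma rotation_domain_invariant:
  "z \<in> D_A \<Longrightarrow> T z \<in> D_A" "z \<in> D_B \<Longrightarrow> T z \<in> D_B"
  unfolding D_A_def D_B_def
  by (auto simp: funpow_swap1[symmetric] T_in_unit_square simp del: T.simps mult_A.simps)
     (metis funpow_swap1 funpow.simps(2) o_apply)+

lemma min_period_rotation_domain:
  assumes "z \<in> D_A \<union> D_B" "T z \<noteq> z"
  shows "min_period z = 5"
proof -
  obtain x y where xy: "z = (x, y)" by (cases z)
  have "(T ^^ 5) z = z"
    using assms(1) rotation_orbit(4)[OF _ xy] by (auto simp: D_A_def D_B_def)
  then show ?thesis
    using min_period_eqI[of z 5] funpow_period_five[of T z] assms(2)
    by (simp add: numeral_eq_enat)
qed

lemma centers_fixed_by_rotation: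
  assumes "c \<in> {1, 2}"
  shows "(c / (golden\<^sup>2 + 1), c / (golden\<^sup>2 + 1)) \<in> unit_square"
    "mult_A (c / (golden\<^sup>2 + 1), c / (golden\<^sup>2 + 1)) + (0, c) = (c / (golden\<^sup>2 + 1), c / (golden\<^sup>2 + 1))"
  unfolding multiple_center_eq[of c] using assms golden_lt golden_gt
  by (auto simp: unit_square_def field_simps golden_sq golden_sq')

lemma centers_in_rotation_domains:
  "(1 / (golden\<^sup>2 + 1), 1 / (golden\<^sup>2 + 1)) \<in> D_A"
  "(2 / (golden\<^sup>2 + 1), 2 / (golden\<^sup>2 + 1)) \<in> D_B"
  using centers_fixed_by_rotation[of 1] centers_fixed_by_rotation[of 2]
    funpow_fixed[of T, OF T_center[of 1]] funpow_fixed[of T, OF T_center[of 2]]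
  unfolding D_A_def D_B_def by (simp_all del: T.simps mult_A.simps funpow.simps)

lemma U_centers:
  "U (1 / (golden\<^sup>2 + 1), 1 / (golden\<^sup>2 + 1))
     = (golden\<^sup>2 / (golden\<^sup>2 + 1), golden\<^sup>2 / (golden\<^sup>2 + 1))"
  "U (2 / (golden\<^sup>2 + 1), 2 / (golden\<^sup>2 + 1)) = (3 / (golden\<^sup>2 + 1), 3 / (golden\<^sup>2 + 1))"
  unfolding alpha_center_eq multiple_center_eq[of 1] multiple_center_eq[of 2] multiple_center_eq[of 3]
  by (simp_all add: U_eq field_simps golden_sq golden_sq')

text \<open>The inequalities that place \<open>U z\<close> in the triangle and in one of its branches. They say that the
  iterates \<open>T z\<close> and \<open>(T ^^ 3) z\<close>, given by the affine formulas, lie in the square.\<close>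

lemma rotation_domain_bounds:
  assumes "\<And>k. (T ^^ Suc k) z = mult_A ((T ^^ k) z) + (0, c)"
    and "z = (x, y)" "z \<in> unit_square" "1 \<le> c"
  shows "2 - golden \<le> x + y" "x + golden * y \<le> c" "c - 1 < x + golden * y"
proof -
  have unit: "(T ^^ k) z \<in> unit_square" for k
    using assms(3) T_in_unit_square by (induction k) auto
  note orb = rotation_orbit[OF assms(1,2)]
  show "x + golden * y \<le> c" "c - 1 < x + golden * y"
    using unit[of 1] orb(1) by (auto simp: unit_square_def)
  have "0 \<le> c - c * golden + golden * (x + y)"
    using unit[of 3] unfolding orb(2) by (auto simp: unit_square_def)
  moreover have "c * (golden - 1) \<ge> 1 * (golden - 1)"
    using assms(4) golden_gt by (intro mult_right_mono) auto
  ultimately have "golden - 1 \<le> golden * (x + y)" by (simp add: algebra_simps)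
  then have "(golden - 1) * (golden - 1) \<le> (golden - 1) * (golden * (x + y))"
    using golden_gt by (intro mult_left_mono) auto
  then show "2 - golden \<le> x + y" by (simp add: algebra_simps golden_sq golden_sq')
qed

lemma U_in_domD:
  assumes "(x, y) \<in> unit_square" "2 - golden \<le> x + y"
  shows "U (x, y) \<in> domD"
proof -
  have "(2 - golden) * x < 2 - golden" "(2 - golden) * y < 2 - golden"
    "(2 - golden) * (2 - golden) \<le> (2 - golden) * (x + y)"
    using assms golden_lt by (auto simp: unit_square_def)
  then show ?thesis by (simp add: U_eq domD_iff algebra_simps golden_sq golden_sq')
qed

lemma upper_U: "upper (U (x, y)) \<longleftrightarrow> x + golden * y > 1"
proof -
  have "fst (U (x, y)) + golden * snd (U (x, y)) - 2 = (2 - golden) * (x + golden * y - 1)"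
    by (simp add: U_eq algebra_simps golden_sq golden_sq')
  moreover have "(2 - golden) * (x + golden * y - 1) > 0 \<longleftrightarrow> x + golden * y - 1 > 0"
    using golden_lt by (simp add: zero_less_mult_iff)
  ultimately show ?thesis unfolding upper_def by linarith
qed

text \<open>The lower branch of \<open>T_hat\<close> has linear part inverse to that of \<open>T\<close>, and \<open>T ^^ 4\<close> is the
  inverse of \<open>T\<close> on \<open>D_A\<close>.\<close>

lemma T_hat_U_rotation_A:
  assumes "z \<in> D_A"
  shows "U z \<in> domD" "\<not> upper (U z)" "T_hat (U z) = U ((T ^^ 4) z)"
proof -
  obtain x y where xy: "z = (x, y)" by (cases z)
  have z: "z \<in> unit_square" "\<And>k. (T ^^ Suc k) z = mult_A ((T ^^ k) z) + (0, 1)"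
    using assms by (auto simp: D_A_def)
  note bd = rotation_domain_bounds[OF z(2) xy z(1)]
  show D: "U z \<in> domD" using U_in_domD bd(1) z(1) by (simp add: xy)
  show low: "\<not> upper (U z)" using upper_U bd(2) by (simp add: xy)
  show "T_hat (U z) = U ((T ^^ 4) z)"
    using T_hat_lower(1) D low unfolding rotation_orbit(3)[OF z(2) xy]
    by (simp add: xy U_eq) (simp add: algebra_simps golden_sq golden_sq')
qed

text \<open>Conjugation by \<open>U\<close> turns the translation part 2 into 3, the one of the upper branch.\<close>

lemma T_hat_U_rotation_B:
  assumes "z \<in> D_B"
  shows "U z \<in> domD" "upper (U z)" "T_hat (U z) = U (T z)"
proof -
  obtain x y where xy: "z = (x, y)" by (cases z)
  have z: "z \<in> unit_square" "\<And>k. (T ^^ Suc k) z = mult_A ((T ^^ k) z) + (0, 2)"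
    using assms by (auto simp: D_B_def)
  note bd = rotation_domain_bounds[OF z(2) xy z(1)]
  show D: "U z \<in> domD" using U_in_domD bd(1) z(1) by (simp add: xy)
  show up: "upper (U z)" using upper_U bd(3) by (simp add: xy)
  show "T_hat (U z) = U (T z)"
    using T_hat_upper D up unfolding rotation_orbit(1)[OF z(2) xy]
    by (simp add: xy U_eq) (simp add: algebra_simps golden_sq golden_sq')
qed

lemma funpow_conjugate:
  assumes "\<And>x. x \<in> A \<Longrightarrow> f x \<in> A \<and> G (u x) = u (f x)" "x \<in> A"
  shows "(f ^^ i) x \<in> A \<and> (G ^^ i) (u x) = u ((f ^^ i) x)"
  using assms by (induction i) auto

lemma min_period_D_alpha:
  assumes "w \<in> D_alpha"
  shows "min_period ((U ^^ n) w)
    = enat ((if w = (golden\<^sup>2 / (golden\<^sup>2 + 1), golden\<^sup>2 / (golden\<^sup>2 + 1)) then 1 else 5)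
        * (2 * (5 * 4 ^ n + 1) div 3))"
proof -
  obtain z where z: "z \<in> D_A" "w = U z" using assms by (auto simp: D_alpha_def)
  obtain x y where xy: "z = (x, y)" by (cases z)
  have step: "\<And>k. (T ^^ Suc k) z = mult_A ((T ^^ k) z) + (0, 1)"
    using z(1) by (auto simp: D_A_def)
  have five: "(T ^^ 5) z = z" by (rule rotation_orbit(4)[OF step xy])
  have inv: "(T ^^ k) z' \<in> D_A" if "z' \<in> D_A" for z' k
    using that rotation_domain_invariant(1) by (induction k) auto
  have conj: "((T ^^ 4) ^^ i) z \<in> D_A \<and> (T_hat ^^ i) (U z) = U (((T ^^ 4) ^^ i) z)" for i
    using funpow_conjugate[of D_A "T ^^ 4" T_hat U z i] inv T_hat_U_rotation_A(3) z(1) by blast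
  \<comment> \<open>Five steps of \<open>T_hat\<close> correspond to twenty steps of \<open>T\<close> in \<open>D_A\<close>.\<close>
  have "(T ^^ 20) z = z"
    using funpow_fixed[of "T ^^ 5", OF five, of 4] by (simp add: funpow_mult)
  then have "(T_hat ^^ 5) (U z) = U z" using conj[of 5] by (simp add: funpow_mult)
  moreover have "upper ((T_hat ^^ i) (U z)) \<longleftrightarrow> upper (U z)" for i
    using conj[of i] T_hat_U_rotation_A(2) z(1) by auto
  moreover have "T_hat (U z) = U z \<longleftrightarrow> w = (golden\<^sup>2 / (golden\<^sup>2 + 1), golden\<^sup>2 / (golden\<^sup>2 + 1))"
  proof -
    have "T_hat (U z) = U z \<longleftrightarrow> (T ^^ 4) z = z"
      by (simp only: T_hat_U_rotation_A(3)[OF z(1)] inj_eq[OF inj_U])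
    also have "\<dots> \<longleftrightarrow> T z = z"
    proof
      assume "(T ^^ 4) z = z"
      moreover have "T ((T ^^ 4) z) = z" using five by (simp add: eval_nat_numeral)
      ultimately show "T z = z" by simp
    qed (rule funpow_fixed)
    also have "\<dots> \<longleftrightarrow> w = (golden\<^sup>2 / (golden\<^sup>2 + 1), golden\<^sup>2 / (golden\<^sup>2 + 1))"
      unfolding U_centers(1)[symmetric] z(2) inj_eq[OF inj_U] xy
      using rotation_fixed_iff[of x y 1] rotation_orbit(1)[OF step xy] by (simp add: xy)
    finally show ?thesis .
  qed
  ultimately show ?thesis
    using min_period_U_power[OF T_hat_U_rotation_A(1)[OF z(1)], of n] T_hat_U_rotation_A(2)[OF z(1)]
    by (simp add: return_time_def z(2))
qed

lemma min_period_D_beta: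
  assumes "w \<in> D_beta"
  shows "min_period ((U ^^ n) w)
    = enat ((if w = (3 / (golden\<^sup>2 + 1), 3 / (golden\<^sup>2 + 1)) then 1 else 5) * ((5 * 4 ^ n - 2) div 3))"
proof -
  obtain z where z: "z \<in> D_B" "w = U z" using assms by (auto simp: D_beta_def)
  obtain x y where xy: "z = (x, y)" by (cases z)
  have step: "\<And>k. (T ^^ Suc k) z = mult_A ((T ^^ k) z) + (0, 2)"
    using z(1) by (auto simp: D_B_def)
  have conj: "(T ^^ i) z \<in> D_B \<and> (T_hat ^^ i) (U z) = U ((T ^^ i) z)" for i
    using funpow_conjugate[of D_B T T_hat U z i] rotation_domain_invariant(2)
      T_hat_U_rotation_B(3) z(1) by blast
  have "(T_hat ^^ 5) (U z) = U z"
    using conj[of 5] rotation_orbit(4)[OF step xy] by simp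
  moreover have "upper ((T_hat ^^ i) (U z)) \<longleftrightarrow> upper (U z)" for i
    using conj[of i] T_hat_U_rotation_B(2) z(1) by auto
  moreover have "T_hat (U z) = U z \<longleftrightarrow> w = (3 / (golden\<^sup>2 + 1), 3 / (golden\<^sup>2 + 1))"
  proof -
    have "T_hat (U z) = U z \<longleftrightarrow> T z = z"
      by (simp only: T_hat_U_rotation_B(3)[OF z(1)] inj_eq[OF inj_U])
    also have "\<dots> \<longleftrightarrow> w = (3 / (golden\<^sup>2 + 1), 3 / (golden\<^sup>2 + 1))"
      unfolding U_centers(2)[symmetric] z(2) inj_eq[OF inj_U] xy
      using rotation_fixed_iff[of x y 2] rotation_orbit(1)[OF step xy] by (simp add: xy)
    finally show ?thesis .
  qed
  ultimately show ?thesis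
    using min_period_U_power[OF T_hat_U_rotation_B(1)[OF z(1)], of n] T_hat_U_rotation_B(2)[OF z(1)]
    by (simp add: return_time_def z(2))
qed

theorem theorem4p1:
  fixes s :: "real \<times> real \<Rightarrow> int" and z :: "real \<times> real"
  assumes "admissible s" and "z \<in> unit_square"
  shows "(z \<in> {(0, 0), (1 / (golden\<^sup>2 + 1), 1 / (golden\<^sup>2 + 1)), (2 / (golden\<^sup>2 + 1), 2 / (golden\<^sup>2 + 1))} \<longrightarrow> min_period z = 1)
    \<and> (z \<in> (D_A \<union> D_B)
             - {(0, 0), (1 / (golden\<^sup>2 + 1), 1 / (golden\<^sup>2 + 1)), (2 / (golden\<^sup>2 + 1), 2 / (golden\<^sup>2 + 1))} \<longrightarrow> min_period z = 5)
    \<and> (\<forall>n. SR s n z = Some (golden\<^sup>2 / (golden\<^sup>2 + 1), golden\<^sup>2 / (golden\<^sup>2 + 1))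
           \<longrightarrow> min_period z = enat (2 * (5 * 4 ^ n + 1) div 3))
    \<and> (\<forall>n w. SR s n z = Some w \<and> w \<in> D_alpha - {(golden\<^sup>2 / (golden\<^sup>2 + 1), golden\<^sup>2 / (golden\<^sup>2 + 1))}
           \<longrightarrow> min_period z = enat (10 * (5 * 4 ^ n + 1) div 3))
    \<and> (\<forall>n. SR s n z = Some (3 / (golden\<^sup>2 + 1), 3 / (golden\<^sup>2 + 1))
           \<longrightarrow> min_period z = enat ((5 * 4 ^ n - 2) div 3))
    \<and> (\<forall>n w. SR s n z = Some w \<and> w \<in> D_beta - {(3 / (golden\<^sup>2 + 1), 3 / (golden\<^sup>2 + 1))}
           \<longrightarrow> min_period z = enat (5 * (5 * 4 ^ n - 2) div 3))
    \<and> ((\<forall>n. \<exists>w. SR s n z = Some w \<and> w \<in> domD - setP) \<longrightarrow> min_period z = \<infinity>)"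
proof -
  let ?a = "(golden\<^sup>2 / (golden\<^sup>2 + 1), golden\<^sup>2 / (golden\<^sup>2 + 1))"
  let ?b = "(3 / (golden\<^sup>2 + 1), 3 / (golden\<^sup>2 + 1))"
  let ?C = "{(0, 0), (1 / (golden\<^sup>2 + 1), 1 / (golden\<^sup>2 + 1)), (2 / (golden\<^sup>2 + 1), 2 / (golden\<^sup>2 + 1))}"
  note period = SR_min_period[OF assms]
  have fixed: "min_period z = 1" if "z \<in> ?C"
  proof -
    have "T z = z" using that T_center[of 0] T_center[of 1] T_center[of 2] by auto
    then show ?thesis
      using min_period_eqI[of z 1] funpow_fixed[of T z] by (simp add: one_enat_def)
  qed
  have rotated: "min_period z = 5" if z: "z \<in> (D_A \<union> D_B) - ?C"
  proof (rule min_period_rotation_domain)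
    show "z \<in> D_A \<union> D_B" using z by simp
    obtain x y where xy: "z = (x, y)" by (cases z)
    from z consider "T z = (y, 1 - x - golden * y)" | "T z = (y, 2 - x - golden * y)"
      using rotation_orbit(1)[OF _ xy] by (auto simp: D_A_def D_B_def)
    then show "T z \<noteq> z"
      using rotation_fixed_iff[of x y 1] rotation_fixed_iff[of x y 2] z by cases (auto simp: xy simp del: T.simps)
  qed
  have centers: "?a \<in> D_alpha" "?b \<in> D_beta"
    using centers_in_rotation_domains U_centers by (auto simp: D_alpha_def D_beta_def intro!: rev_image_eqI)
  have alpha: "min_period z = enat ((if w = ?a then 1 else 5) * (2 * (5 * 4 ^ n + 1) div 3))"
    if "SR s n z = Some w" "w \<in> D_alpha" for n w
    using period[OF that(1)] min_period_D_alpha[OF that(2), of n] by simp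
  have beta: "min_period z = enat ((if w = ?b then 1 else 5) * ((5 * 4 ^ n - 2) div 3))"
    if "SR s n z = Some w" "w \<in> D_beta" for n w
    using period[OF that(1)] min_period_D_beta[OF that(2), of n] by simp
  have infinite: "min_period z = \<infinity>" if "\<forall>n. \<exists>w. SR s n z = Some w \<and> w \<in> domD - setP"
    using that period by (intro min_period_infinite) blast
  have "5 * (2 * (5 * 4 ^ n + 1) div 3) = 10 * (5 * 4 ^ n + 1) div (3::nat)"
    and "5 * ((5 * 4 ^ n - 2) div 3) = 5 * (5 * 4 ^ n - 2) div (3::nat)" for n
    using div_mult_swap[of 3 "2 * (5 * 4 ^ n + 1)" "5::nat"] div_mult_swap[of 3 "5 * 4 ^ n - 2" "5::nat"]
      dvd_mult[OF three_dvd_period_lengths(1), of 2 n] three_dvd_period_lengths(2)[of n] by simp_all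
  then show ?thesis
    using fixed rotated alpha beta centers infinite by (auto simp del: T.simps)
qed

end
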